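(* Let $p$ be a prime, $L\ge 0$ an integer, and $k$ an integer with $0\le k<(p-1)p^{L}$. The period of the binomial sequence $\left\{\binom{n}{p^L+k}\right\}_{n\ge 0}$ modulo $p$ is $T=p^{L+1}$.
   Context: For an integer $m\ge 0$, the $m$-th ($p$-ary) binomial sequence $\left\{\binom{n}{m}\right\}_{n\ge0}$ is the sequence over $\mathbb{F}_p$ with $n$-th term $\binom{n}{m}\bmod p$, with $\binom{n}{m}=0$ for $n<m$. The period of a periodic sequence $\{s_n\}$ is the least positive integer $T$ with $s_{n+T}=s_n$ for all $n\ge 0$. *)

theory Defs
  imports "HOL-Computational_Algebra.Primes"
begin

(* Elements of F_p are represented by their residues in {0..<p}. *)
definition binomial_seq :: "nat \<Rightarrow> nat \<Rightarrow> nat \<Rightarrow> nat" where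
  "binomial_seq p m n = (n choose m) mod p"

definition periodic :: "(nat \<Rightarrow> 'a) \<Rightarrow> bool" where
  "periodic s \<longleftrightarrow> (\<exists>T>0. \<forall>n. s (n + T) = s n)"

(* Meaningful only if s is periodic; otherwise the value is unspecified. *)
definition period :: "(nat \<Rightarrow> 'a) \<Rightarrow> nat" where
  "period s = (LEAST T. T > 0 \<and> (\<forall>n. s (n + T) = s n))"

end

theory Submission imports Defs "HOL-Number_Theory.Cong" begin

text \<open>
  Since \<open>p\<close> divides \<open>(q choose i)\<close> for \<open>q = p ^ e\<close> and \<open>0 < i < q\<close>, Vandermonde's identity reduces
  modulo \<open>p\<close> to \<open>(n + q choose m) = (n choose m) + (n choose m - q)\<close>, the last term being absent
  when \<open>m < q\<close>. Hence \<open>p ^ (L + 1)\<close> is a period of the \<open>m\<close>-th sequence when \<open>m < p ^ (L + 1)\<close>,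
  so the least period divides it. Were it smaller, \<open>p ^ L\<close> would be a period as well, forcing
  \<open>(n choose m - p ^ L)\<close> to vanish modulo \<open>p\<close> for all \<open>n\<close>; but it is \<open>1\<close> at \<open>n = m - p ^ L\<close>.
\<close>

text \<open>By absorption, \<open>i * (p ^ e choose i)\<close> is a multiple of
  \<open>p ^ e\<close>. Were the coefficient prime to \<open>p\<close>, all of \<open>p ^ e\<close>
  would have to divide \<open>i\<close>, which is too small.\<close>

lemma prime_dvd_prime_power_choose:
  fixes p e i :: nat
  assumes "prime p" "0 < i" "i < p ^ e"
  shows "p dvd (p ^ e choose i)"
proof (rule ccontr)
  assume "\<not> p dvd (p ^ e choose i)"
  then have "coprime (p ^ e) (p ^ e choose i)"
    using assms(1) by (simp add: prime_imp_coprime)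
  moreover have "p ^ e dvd i * (p ^ e choose i)"
    using times_binomial_minus1_eq[OF assms(2)] by simp
  ultimately have "p ^ e dvd i"
    by (simp add: coprime_dvd_mult_left_iff)
  then show False
    using assms(2,3) by (simp add: nat_dvd_not_less)
qed

lemma choose_add_prime_power_cong:
  fixes p e n m :: nat
  assumes "prime p"
  shows "[(n + p ^ e choose m) = (n choose m) + (if p ^ e \<le> m then n choose (m - p ^ e) else 0)] (mod p)"
proof -
  let ?q = "p ^ e"
  have q: "?q > 0"
    using assms by (simp add: prime_gt_0_nat)
  have "(n + ?q choose m) = (\<Sum>i\<le>m. (?q choose i) * (n choose (m - i)))"
    by (simp add: vandermonde add.commute)
  \<comment> \<open>Two separate indicators let the sum split into single-term sums; the second is
    empty when \<open>?q > m\<close>. They never overlap, as \<open>?q > 0\<close>.\<close>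
  also have "[\<dots> = (\<Sum>i\<le>m. (if i = 0 then n choose m else 0)
      + (if i = ?q then n choose (m - ?q) else 0))] (mod p)"
  proof (rule cong_sum)
    fix i
    consider "i = 0" | "0 < i" "i < ?q" | "i = ?q" | "i > ?q"
      by linarith
    then show "[(?q choose i) * (n choose (m - i)) = (if i = 0 then n choose m else 0)
      + (if i = ?q then n choose (m - ?q) else 0)] (mod p)"
    proof cases
      case 2
      then show ?thesis
        using prime_dvd_prime_power_choose[OF assms] by (simp add: cong_0_iff)
    qed (use q in \<open>auto simp: binomial_eq_0\<close>)
  qed
  also have "(\<Sum>i\<le>m. (if i = 0 then n choose m else 0)
      + (if i = ?q then n choose (m - ?q) else 0))
      = (n choose m) + (if ?q \<le> m then n choose (m - ?q) else 0)"
    by (simp add: sum.distrib)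
  finally show ?thesis .
qed

lemma period_multiple:
  fixes s :: "nat \<Rightarrow> 'a"
  assumes "\<And>n. s (n + T) = s n"
  shows "s (n + c * T) = s n"
proof (induction c)
  case (Suc c)
  have "s (n + Suc c * T) = s ((n + c * T) + T)"
    by (simp add: algebra_simps)
  then show ?case
    using assms Suc.IH by simp
qed simp

lemma
  fixes s :: "nat \<Rightarrow> 'a"
  assumes "periodic s"
  shows period_pos: "period s > 0"
    and period_shift: "s (n + period s) = s n"
proof -
  have "period s > 0 \<and> (\<forall>n. s (n + period s) = s n)"
    using assms unfolding periodic_def period_def by (rule LeastI_ex)
  then show "period s > 0" "s (n + period s) = s n"
    by auto
qed

text \<open>Otherwise \<open>P mod period s\<close> would be a smaller positive period: shifting by
  it agrees with shifting by \<open>P\<close>, which only adds whole periods.\<close>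

lemma period_dvd:
  fixes s :: "nat \<Rightarrow> 'a"
  assumes "periodic s" "\<And>n. s (n + P) = s n"
  shows "period s dvd P"
proof (rule ccontr)
  let ?T = "period s" and ?r = "P mod period s"
  assume "\<not> ?T dvd P"
  then have "?r > 0"
    by (simp add: mod_greater_zero_iff_not_dvd)
  moreover have "s (n + ?r) = s n" for n
  proof -
    have "s (n + ?r) = s ((n + ?r) + (P div ?T) * ?T)"
      by (rule period_multiple[of s, OF period_shift[OF assms(1)], symmetric])
    also have "\<dots> = s (n + P)"
      by (simp only: add.assoc mod_div_mult_eq)
    finally show ?thesis
      using assms(2) by simp
  qed
  ultimately have "?T \<le> ?r"
    by (subst period_def, intro Least_le) simp
  then show False
    using mod_less_divisor[OF period_pos[OF assms(1)], of P] by linarith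
qed

theorem theorem5:
  fixes p L k :: nat
  assumes "prime p"
    and "k < (p - 1) * p ^ L"
  shows "periodic (binomial_seq p (p ^ L + k)) \<and>
         period (binomial_seq p (p ^ L + k)) = p ^ (L + 1)"
proof -
  let ?m = "p ^ L + k"
  let ?s = "binomial_seq p ?m"
  have p: "p > 1"
    using assms(1) by (rule prime_gt_1_nat)
  \<comment> \<open>The bound on \<open>k\<close> says exactly that \<open>?m\<close> stays below
    \<open>p ^ (L + 1)\<close>, so the extra term is absent.\<close>
  have "p ^ L + (p - 1) * p ^ L = p ^ (L + 1)"
    using p by (simp add: diff_mult_distrib)
  then have m: "?m < p ^ (L + 1)"
    using assms(2) by linarith
  have per: "?s (n + p ^ (L + 1)) = ?s n" for n
    using choose_add_prime_power_cong[OF assms(1), of n "L + 1" ?m] m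
    by (simp add: binomial_seq_def cong_def)
  have periodic: "periodic ?s"
    unfolding periodic_def using per p by (intro exI[of _ "p ^ (L + 1)"]) simp
  obtain i where i: "i \<le> L + 1" "period ?s = p ^ i"
    using period_dvd[of ?s, OF periodic per] divides_primepow_nat[OF assms(1)] by blast
  have "\<not> i \<le> L"
  proof
    assume "i \<le> L"
    then have "p ^ L = p ^ (L - i) * period ?s"
      by (simp add: i(2) flip: power_add)
    \<comment> \<open>The index \<open>k\<close> is \<open>?m - p ^ L\<close>, so the extra term is
      \<open>k choose k\<close>.\<close>
    then have "?s (k + p ^ L) = ?s k"
      using period_multiple[of ?s, OF period_shift[OF periodic], of k "p ^ (L - i)"] by metis
    moreover have "[(k + p ^ L choose ?m) = (k choose ?m) + 1] (mod p)"
      using choose_add_prime_power_cong[OF assms(1), of k L ?m] by simp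
    ultimately have "[(k choose ?m) + 1 = (k choose ?m)] (mod p)"
      by (simp add: binomial_seq_def cong_def)
    then have "[1 = 0] (mod p)"
      by (simp only: cong_add_lcancel_0_nat)
    then show False
      using p by (simp add: cong_def)
  qed
  then have "i = L + 1"
    using i(1) by simp
  then show ?thesis
    using periodic i(2) by simp
qed

end
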